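(* In the setting described in the context, suppose the following hold. (1) There exists $\gamma\in(0,1)$ such that $T_\theta(\cdot;t,z)$ is $\gamma$-contractive in $u$ for all $t\in[0,T]$, $z\in\mathbb{R}^n$, $\theta\in\mathbb{R}^p$; and $T_\theta$ is continuously differentiable with respect to $\theta,t,u,z$. (2) There is $\beta>0$ such that for all $\theta,t,u,z$ the matrix $M_\theta=\frac{\partial T_\theta}{\partial\theta}(u;t,z)\in\mathbb{R}^{m\times p}$ satisfies $\sqrt{\gamma/\beta}\le\sigma_{\min}(M_\theta)\le\sigma_{\max}(M_\theta)\le 1/\sqrt{\beta}$, where $\gamma$ is the contraction factor in (1). (3) There exists $\eta>0$ such that for all initial conditions $x$, all $t\in[0,T]$ and all $\theta$, $\|\nabla_uL(t,z_x,u_\theta^\star)+\nabla_uf^\top p_x\|\ge\eta$, where all quantities are evaluated at time $t$ along the trajectory $z_x$ with control $u_\theta^\star$. (4) Let $C_v=\frac1T\int_0^Tv_\theta(t)\,dt$ and $C_w=\frac1T\int_0^Tw_\theta(t)\,dt$. For all $x$ and $\theta$, the functions $v_\theta,w_\theta$ are entrywise in $L^2[0,T]$ with respect to $t$, and for all $t\in[0,T]$ $$\|v_\theta(t)-C_v\|<\|M_\theta v_\theta(t)\|\sqrt{\lambda_--\gamma\lambda_+},\qquad \|w_\theta(t)-C_w\|<\|M_\theta w_\theta(t)\|\sqrt{\lambda_--\gamma\lambda_+}.$$ Here $M_\theta$ is evaluated at $(u_\theta^\star(t,z_x(t));t,z_x(t))$, and $\lambda_-,\lambda_+$ are the uniform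 eigenvalue bounds described in the context. Then for every $x$ and $\theta$, the negative JFB approximation of the gradient $$-\frac{d\tilde J_x(\theta)}{d\theta}=-\int_0^Tw_\theta(t)\,dt$$ is a descent direction for $J_x(\theta)$ with respect to $\theta$, that is, $\left\langle \frac{dJ_x(\theta)}{d\theta},\,-\frac{d\tilde J_x(\theta)}{d\theta}\right\rangle<0$.
   Context: Norms are Euclidean (spectral for matrices); $\sigma_{\min},\sigma_{\max}$ denote the smallest and largest singular values (for $M_\theta\in\mathbb{R}^{m\times p}$, $\sigma_{\min}(M_\theta)^2=\lambda_{\min}(M_\theta M_\theta^\top)$). Optimal control problem. $T>0$ is a fixed time horizon (not to be confused with the operator $T_\theta$). $f(t,z,u)\in\mathbb{R}^n$ is the dynamics, $L(t,z,u)\in\mathbb{R}$ the running cost and $G(z)\in\mathbb{R}$ the terminal cost, for $t\in[0,T]$, $z\in\mathbb{R}^n$, $u\in\mathbb{R}^m$, all differentiable as needed. The generalized Hamiltonian is $\mathcal{H}(t,z,p,u)=-\langle p,f(t,z,u)\rangle-L(t,z,u)$. A function $\phi_\theta(t,z)\in\mathbb{R}$ with parameters $\theta\in\mathbb{R}^p$ parameterizes the value function. For $\alpha>0$ define the operator $$T_\theta(u;t,z)=u+\alpha\nabla_u\mathcal{H}(t,z,\nabla_z\phi_\theta(t,z),u),\qquad u\in\mathbb{R}^m.$$ The feedback control $u_\theta^\star=u_\theta^\star(t,z)\in\mathrm{arg\,max}_u\,\mathcal{H}(t,z,\nabla_z\phi_\theta(t,z),u)$ is the fixed point $u_\theta^\star=T_\theta(u_\theta^\star;t,z)$.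 For an initial condition $x\in\mathbb{R}^n$, the trajectory $z_x$ solves $\dot z_x=f(t,z_x,u_\theta^\star)$, $z_x(0)=x$ (with $u_\theta^\star=u_\theta^\star(t,z_x(t))$), and $$J_x(\theta)=\int_0^TL(s,z_x,u_\theta^\star)\,ds+G(z_x(T)).$$ Gradients. Let $\mathcal{J}_\theta=I-\frac{\partial T_\theta}{\partial u}(u_\theta^\star;t,z)$. The implicit derivative of the fixed point is $\frac{du_\theta^\star}{d\theta}(t,z)=\mathcal{J}_\theta^{-1}\frac{\partial T_\theta}{\partial\theta}(u_\theta^\star;t,z)\in\mathbb{R}^{m\times p}$. Along the trajectory, with everything evaluated at $(t,z_x(t),u_\theta^\star(t,z_x(t)))$, set $$v_\theta(t)=\Big(\frac{du_\theta^\star}{d\theta}\Big)^{\top}\big(\nabla_uL+\nabla_uf^\top p_x(t)\big),\qquad w_\theta(t)=\Big(\frac{\partial T_\theta}{\partial\theta}\Big)^{\top}\big(\nabla_uL+\nabla_uf^\top p_x(t)\big),$$ where $\nabla_u f$ is the Jacobian of $f$ in $u$ and $p_x:[0,T]\to\mathbb{R}^n$ is the adjoint trajectory, i.e. the solution of the adjoint equation corresponding to $J_x$, for which the true gradient has the representation $$\frac{dJ_x(\theta)}{d\theta}=\int_0^Tv_\theta(t)\,dt.$$ This representation is taken as part of the setting. The Jacobian-Free Backpropagation (JFB) approximation of the gradient is $\frac{d\tilde J_x(\theta)}{d\theta}=\int_0^Tw_\theta(t)\,dt$. Eigenvalue bounds. $0<\lambda_-<\lambda_+$ are constants with $\lambda_-I\preceq(M_\theta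 M_\theta^\top)^{-1}\preceq\lambda_+I$ for all $t,z,u,\theta$ (such constants exist under the singular value bounds in hypothesis (2)). *)

theory Defs
  imports "HOL-Analysis.Analysis"
begin

section \<open>Calculus and matrix notions\<close>

definition grad :: "('a::real_inner \<Rightarrow> real) \<Rightarrow> 'a \<Rightarrow> 'a" where
  "grad F x = (THE g. GDERIV F x :> g)"

definition descent_direction :: "('a::real_inner \<Rightarrow> real) \<Rightarrow> 'a \<Rightarrow> 'a \<Rightarrow> bool" where
  "descent_direction F x d \<longleftrightarrow> F differentiable (at x) \<and> grad F x \<bullet> d < 0"

text \<open>The derivative is taken within \<open>S\<close>, so it is one-sided in time at the
  end points of the horizon.\<close>

definition cont_diff_on ::
  "('a::real_normed_vector \<Rightarrow> 'b::real_normed_vector) \<Rightarrow> 'a set \<Rightarrow> bool" where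
  "cont_diff_on F S \<longleftrightarrow>
    (\<exists>D :: 'a \<Rightarrow> 'a \<Rightarrow>\<^sub>L 'b.
      (\<forall>q\<in>S. (F has_derivative blinfun_apply (D q)) (at q within S)) \<and> continuous_on S D)"

definition is_eigenvalue :: "real^'m^'m \<Rightarrow> real \<Rightarrow> bool" where
  "is_eigenvalue A c \<longleftrightarrow> (\<exists>x. x \<noteq> 0 \<and> A *v x = c *\<^sub>R x)"

text \<open>An \<open>m \<times> p\<close> matrix has \<open>m\<close> singular values here (the square roots of the eigenvalues of
  \<open>A A\<^sup>T\<close>), so the smallest one is \<open>0\<close> if \<open>p < m\<close>.\<close>

definition singular_values :: "real^'p^'m \<Rightarrow> real set" where
  "singular_values A = {s. 0 \<le> s \<and> is_eigenvalue (A ** transpose A) (s\<^sup>2)}"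

definition sigma_min :: "real^'p^'m \<Rightarrow> real" where
  "sigma_min A = Min (singular_values A)"

definition sigma_max :: "real^'p^'m \<Rightarrow> real" where
  "sigma_max A = Max (singular_values A)"

definition pos_semidef :: "real^'m^'m \<Rightarrow> bool" where
  "pos_semidef A \<longleftrightarrow> transpose A = A \<and> (\<forall>x. 0 \<le> x \<bullet> (A *v x))"

definition loewner_le :: "real^'m^'m \<Rightarrow> real^'m^'m \<Rightarrow> bool"  (infix \<open>\<preceq>\<^sub>L\<close> 50) where
  "A \<preceq>\<^sub>L B \<longleftrightarrow> pos_semidef (B - A)"

definition L2_entrywise :: "real \<Rightarrow> (real \<Rightarrow> real^'p) \<Rightarrow> bool" where
  "L2_entrywise T g \<longleftrightarrow>
    (\<forall>i. set_borel_measurable lebesgue {0..T} (\<lambda>t. g t $ i) \<and>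
         set_integrable lebesgue {0..T} (\<lambda>t. (g t $ i)\<^sup>2))"

definition time_mean :: "real \<Rightarrow> (real \<Rightarrow> real^'p) \<Rightarrow> real^'p" where
  "time_mean T g = (1 / T) *\<^sub>R (LINT t:{0..T}|lebesgue. g t)"


section \<open>The optimal control problem\<close>

record ('n, 'm, 'p) control_problem =
  horizon :: real
  dyn :: "real \<Rightarrow> real^'n \<Rightarrow> real^'m \<Rightarrow> real^'n"
  run_cost :: "real \<Rightarrow> real^'n \<Rightarrow> real^'m \<Rightarrow> real"
  term_cost :: "real^'n \<Rightarrow> real"
  value_fn :: "real^'p \<Rightarrow> real \<Rightarrow> real^'n \<Rightarrow> real"
  step_size :: real

definition regular_problem :: "('n::finite, 'm::finite, 'p::finite) control_problem \<Rightarrow> bool" where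
  "regular_problem C \<longleftrightarrow>
    0 < horizon C \<and> 0 < step_size C \<and>
    continuous_on ({0..horizon C} \<times> UNIV \<times> UNIV) (\<lambda>(t, z, u). dyn C t z u) \<and>
    continuous_on ({0..horizon C} \<times> UNIV \<times> UNIV) (\<lambda>(t, z, u). run_cost C t z u) \<and>
    (\<forall>t\<in>{0..horizon C}. \<forall>z u.
      (\<lambda>(z, u). dyn C t z u) differentiable (at (z, u)) \<and>
      (\<lambda>(z, u). run_cost C t z u) differentiable (at (z, u))) \<and>
    (\<forall>z. term_cost C differentiable (at z)) \<and>
    (\<forall>\<theta>. \<forall>t\<in>{0..horizon C}. \<forall>z. value_fn C \<theta> t differentiable (at z))"

definition hamiltonian ::
  "('n::finite, 'm::finite, 'p::finite) control_problem \<Rightarrow> real \<Rightarrow> real^'n \<Rightarrow> real^'n \<Rightarrow> real^'m \<Rightarrow> real" where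
  "hamiltonian C t z q u = - (q \<bullet> dyn C t z u) - run_cost C t z u"

text \<open>The Hamiltonian at the costate \<open>\<nabla>\<^sub>z \<phi>\<^sub>\<theta>(t, z)\<close>, as a function of the control.\<close>

definition control_hamiltonian ::
  "('n::finite, 'm::finite, 'p::finite) control_problem \<Rightarrow> real^'p \<Rightarrow> real \<Rightarrow> real^'n \<Rightarrow> real^'m \<Rightarrow> real" where
  "control_hamiltonian C \<theta> t z = hamiltonian C t z (grad (value_fn C \<theta> t) z)"

definition fp_map ::
  "('n::finite, 'm::finite, 'p::finite) control_problem \<Rightarrow> real^'p \<Rightarrow> real \<Rightarrow> real^'n \<Rightarrow> real^'m \<Rightarrow> real^'m" where
  "fp_map C \<theta> t z u = u + step_size C *\<^sub>R grad (control_hamiltonian C \<theta> t z) u"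

definition fp_map_dtheta ::
  "('n::finite, 'm::finite, 'p::finite) control_problem \<Rightarrow> real^'p \<Rightarrow> real \<Rightarrow> real^'n \<Rightarrow> real^'m \<Rightarrow> real^'p^'m" where
  "fp_map_dtheta C \<theta> t z u = jacobian (\<lambda>\<theta>'. fp_map C \<theta>' t z u) (at \<theta>)"

definition fp_map_du ::
  "('n::finite, 'm::finite, 'p::finite) control_problem \<Rightarrow> real^'p \<Rightarrow> real \<Rightarrow> real^'n \<Rightarrow> real^'m \<Rightarrow> real^'m^'m" where
  "fp_map_du C \<theta> t z u = jacobian (fp_map C \<theta> t z) (at u)"


section \<open>Feedback control, trajectory and objective\<close>

text \<open>Argument order: feedback controls are \<open>us \<theta> t z\<close>; state trajectories and adjoints
  are \<open>zs \<theta> x t\<close> and \<open>ps \<theta> x t\<close>, with \<open>x\<close> the initial state.\<close>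

definition feedback_control ::
  "('n::finite, 'm::finite, 'p::finite) control_problem \<Rightarrow>
   (real^'p \<Rightarrow> real \<Rightarrow> real^'n \<Rightarrow> real^'m) \<Rightarrow> bool" where
  "feedback_control C us \<longleftrightarrow>
    (\<forall>\<theta>. \<forall>t\<in>{0..horizon C}. \<forall>z.
      is_arg_max (control_hamiltonian C \<theta> t z) (\<lambda>_. True) (us \<theta> t z) \<and>
      us \<theta> t z = fp_map C \<theta> t z (us \<theta> t z))"

definition state_trajectory ::
  "('n::finite, 'm::finite, 'p::finite) control_problem \<Rightarrow>
   (real^'p \<Rightarrow> real \<Rightarrow> real^'n \<Rightarrow> real^'m) \<Rightarrow>
   (real^'p \<Rightarrow> real^'n \<Rightarrow> real \<Rightarrow> real^'n) \<Rightarrow> bool" where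
  "state_trajectory C us zs \<longleftrightarrow>
    (\<forall>\<theta> x. zs \<theta> x 0 = x \<and>
      (\<forall>t\<in>{0..horizon C}.
        (zs \<theta> x has_vector_derivative dyn C t (zs \<theta> x t) (us \<theta> t (zs \<theta> x t)))
          (at t within {0..horizon C})))"

definition control_objective ::
  "('n::finite, 'm::finite, 'p::finite) control_problem \<Rightarrow>
   (real^'p \<Rightarrow> real \<Rightarrow> real^'n \<Rightarrow> real^'m) \<Rightarrow>
   (real^'p \<Rightarrow> real^'n \<Rightarrow> real \<Rightarrow> real^'n) \<Rightarrow> real^'n \<Rightarrow> real^'p \<Rightarrow> real" where
  "control_objective C us zs x \<theta> =
    (LINT s:{0..horizon C}|lebesgue. run_cost C s (zs \<theta> x s) (us \<theta> s (zs \<theta> x s))) +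
    term_cost C (zs \<theta> x (horizon C))"

text \<open>The objective sees the control only through the feedback law, so its adjoint equation is the
  one of the closed-loop system: the derivatives in \<open>z\<close> of \<open>f(t, z, u\<^sup>\<star>(t, z))\<close> and
  \<open>L(t, z, u\<^sup>\<star>(t, z))\<close> are total derivatives, including the term through \<open>u\<^sup>\<star>\<close>.\<close>

definition adjoint_trajectory ::
  "('n::finite, 'm::finite, 'p::finite) control_problem \<Rightarrow>
   (real^'p \<Rightarrow> real \<Rightarrow> real^'n \<Rightarrow> real^'m) \<Rightarrow>
   (real^'p \<Rightarrow> real^'n \<Rightarrow> real \<Rightarrow> real^'n) \<Rightarrow>
   (real^'p \<Rightarrow> real^'n \<Rightarrow> real \<Rightarrow> real^'n) \<Rightarrow> bool" where
  "adjoint_trajectory C us zs ps \<longleftrightarrow>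
    (\<forall>\<theta> x. ps \<theta> x (horizon C) = grad (term_cost C) (zs \<theta> x (horizon C)) \<and>
      (\<forall>t\<in>{0..horizon C}.
        (ps \<theta> x has_vector_derivative
          - (transpose (jacobian (\<lambda>z. dyn C t z (us \<theta> t z)) (at (zs \<theta> x t))) *v ps \<theta> x t)
          - grad (\<lambda>z. run_cost C t z (us \<theta> t z)) (zs \<theta> x t))
          (at t within {0..horizon C})))"


section \<open>True and Jacobian-free gradients\<close>

definition implicit_derivative ::
  "('n::finite, 'm::finite, 'p::finite) control_problem \<Rightarrow>
   (real^'p \<Rightarrow> real \<Rightarrow> real^'n \<Rightarrow> real^'m) \<Rightarrow> real^'p \<Rightarrow> real \<Rightarrow> real^'n \<Rightarrow> real^'p^'m" where
  "implicit_derivative C us \<theta> t z =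
    matrix_inv (mat 1 - fp_map_du C \<theta> t z (us \<theta> t z)) ** fp_map_dtheta C \<theta> t z (us \<theta> t z)"

definition traj_dtheta ::
  "('n::finite, 'm::finite, 'p::finite) control_problem \<Rightarrow>
   (real^'p \<Rightarrow> real \<Rightarrow> real^'n \<Rightarrow> real^'m) \<Rightarrow>
   (real^'p \<Rightarrow> real^'n \<Rightarrow> real \<Rightarrow> real^'n) \<Rightarrow>
   real^'p \<Rightarrow> real^'n \<Rightarrow> real \<Rightarrow> real^'p^'m" where
  "traj_dtheta C us zs \<theta> x t = fp_map_dtheta C \<theta> t (zs \<theta> x t) (us \<theta> t (zs \<theta> x t))"

definition control_sensitivity ::
  "('n::finite, 'm::finite, 'p::finite) control_problem \<Rightarrow>
   (real^'p \<Rightarrow> real \<Rightarrow> real^'n \<Rightarrow> real^'m) \<Rightarrow>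
   (real^'p \<Rightarrow> real^'n \<Rightarrow> real \<Rightarrow> real^'n) \<Rightarrow>
   (real^'p \<Rightarrow> real^'n \<Rightarrow> real \<Rightarrow> real^'n) \<Rightarrow>
   real^'p \<Rightarrow> real^'n \<Rightarrow> real \<Rightarrow> real^'m" where
  "control_sensitivity C us zs ps \<theta> x t =
    (let z = zs \<theta> x t; u = us \<theta> t z in
      grad (run_cost C t z) u + transpose (jacobian (dyn C t z) (at u)) *v ps \<theta> x t)"

definition v_fn ::
  "('n::finite, 'm::finite, 'p::finite) control_problem \<Rightarrow>
   (real^'p \<Rightarrow> real \<Rightarrow> real^'n \<Rightarrow> real^'m) \<Rightarrow>
   (real^'p \<Rightarrow> real^'n \<Rightarrow> real \<Rightarrow> real^'n) \<Rightarrow>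
   (real^'p \<Rightarrow> real^'n \<Rightarrow> real \<Rightarrow> real^'n) \<Rightarrow>
   real^'p \<Rightarrow> real^'n \<Rightarrow> real \<Rightarrow> real^'p" where
  "v_fn C us zs ps \<theta> x t =
    transpose (implicit_derivative C us \<theta> t (zs \<theta> x t)) *v control_sensitivity C us zs ps \<theta> x t"

definition w_fn ::
  "('n::finite, 'm::finite, 'p::finite) control_problem \<Rightarrow>
   (real^'p \<Rightarrow> real \<Rightarrow> real^'n \<Rightarrow> real^'m) \<Rightarrow>
   (real^'p \<Rightarrow> real^'n \<Rightarrow> real \<Rightarrow> real^'n) \<Rightarrow>
   (real^'p \<Rightarrow> real^'n \<Rightarrow> real \<Rightarrow> real^'n) \<Rightarrow>
   real^'p \<Rightarrow> real^'n \<Rightarrow> real \<Rightarrow> real^'p" where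
  "w_fn C us zs ps \<theta> x t =
    transpose (traj_dtheta C us zs \<theta> x t) *v control_sensitivity C us zs ps \<theta> x t"

definition gradient_representation ::
  "('n::finite, 'm::finite, 'p::finite) control_problem \<Rightarrow>
   (real^'p \<Rightarrow> real \<Rightarrow> real^'n \<Rightarrow> real^'m) \<Rightarrow>
   (real^'p \<Rightarrow> real^'n \<Rightarrow> real \<Rightarrow> real^'n) \<Rightarrow>
   (real^'p \<Rightarrow> real^'n \<Rightarrow> real \<Rightarrow> real^'n) \<Rightarrow> bool" where
  "gradient_representation C us zs ps \<longleftrightarrow>
    (\<forall>\<theta> x. GDERIV (control_objective C us zs x) \<theta> :>
      (LINT t:{0..horizon C}|lebesgue. v_fn C us zs ps \<theta> x t))"

definition jfb_gradient ::
  "('n::finite, 'm::finite, 'p::finite) control_problem \<Rightarrow>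
   (real^'p \<Rightarrow> real \<Rightarrow> real^'n \<Rightarrow> real^'m) \<Rightarrow>
   (real^'p \<Rightarrow> real^'n \<Rightarrow> real \<Rightarrow> real^'n) \<Rightarrow>
   (real^'p \<Rightarrow> real^'n \<Rightarrow> real \<Rightarrow> real^'n) \<Rightarrow> real^'n \<Rightarrow> real^'p \<Rightarrow> real^'p" where
  "jfb_gradient C us zs ps x \<theta> = (LINT t:{0..horizon C}|lebesgue. w_fn C us zs ps \<theta> x t)"

end

theory Submission
  imports Defs
begin

text \<open>Write \<open>h\<close> for the control sensitivity, \<open>g = (\<J>\<^sup>T)\<^sup>-\<^sup>1 h\<close> with \<open>\<J> = I - \<partial>T/\<partial>u\<close>, and
  \<open>K = M M\<^sup>T\<close>, so that \<open>v = M\<^sup>T g\<close>,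
  \<open>w = M\<^sup>T h\<close>, \<open>M v = K g\<close>, \<open>M w = K h\<close> and \<open>v \<bullet> w = g \<bullet> K h\<close>. Contractivity gives
  \<open>norm (h - g) \<le> \<gamma> * norm g\<close>, so the angle between \<open>g\<close> and \<open>h\<close> has sine at most \<open>\<gamma>\<close>, and together with
  the bounds on the inverse of \<open>K\<close> this yields the pointwise estimate
  \<open>(\<lambda>\<^sub>- - \<gamma> \<lambda>\<^sub>+) * norm (M v) * norm (M w) \<le> v \<bullet> w\<close>. By the deviation hypotheses the left-hand side
  exceeds \<open>norm (v - C\<^sub>v) * norm (w - C\<^sub>w)\<close>. Integrating
  \<open>(v - C\<^sub>v) \<bullet> (w - C\<^sub>w) < v \<bullet> w\<close> over the horizon leaves \<open>0 < C\<^sub>v \<bullet> C\<^sub>w\<close>.\<close>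

section \<open>Geometry of two vectors at a small angle\<close>

text \<open>The distance from \<open>q\<close> to the point \<open>r\<close> is at least the
  distance from \<open>q\<close> to the line of \<open>r\<close>. The latter, squared and multiplied
  by \<open>(norm r)\<^sup>2\<close>, is the left-hand side.\<close>

lemma inner_sq_deficit:
  fixes q r :: "'a::real_inner"
  assumes "norm (r - q) \<le> k * norm q"
  shows "(norm q)\<^sup>2 * (norm r)\<^sup>2 - (q \<bullet> r)\<^sup>2 \<le> k\<^sup>2 * (norm q)\<^sup>2 * (norm r)\<^sup>2"
proof -
  have "(norm (r - q))\<^sup>2 \<le> (k * norm q)\<^sup>2"
    using assms norm_ge_zero by (rule power_mono)
  then have "(norm (r - q))\<^sup>2 * (norm r)\<^sup>2 \<le> (k * norm q)\<^sup>2 * (norm r)\<^sup>2"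
    by (rule mult_right_mono) simp
  moreover have "(norm (r - q))\<^sup>2 * (norm r)\<^sup>2
      = (norm q)\<^sup>2 * (norm r)\<^sup>2 - (q \<bullet> r)\<^sup>2 + ((norm r)\<^sup>2 - q \<bullet> r)\<^sup>2"
    by (simp add: power2_norm_eq_inner[of "r - q"] inner_diff inner_commute)
      (simp add: power2_norm_eq_inner[symmetric] power2_eq_square algebra_simps)
  ultimately show ?thesis
    using zero_le_power2[of "(norm r)\<^sup>2 - q \<bullet> r"] unfolding power_mult_distrib by linarith
qed

lemma inner_pos_of_norm_diff_less:
  fixes q r :: "'a::real_inner"
  assumes "norm (r - q) < norm q"
  shows "0 < q \<bullet> r"
proof -
  have "(norm (r - q))\<^sup>2 < (norm q)\<^sup>2"
    using assms by (simp add: power_strict_mono)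
  then have "(norm r)\<^sup>2 < 2 * (q \<bullet> r)"
    by (simp add: power2_norm_eq_inner inner_diff inner_commute)
  then show ?thesis
    using zero_le_power2[of "norm r"] by linarith
qed

text \<open>Replace \<open>q\<close> by its projection \<open>t *\<^sub>R r\<close> on the line of
  \<open>r\<close>. The deficit bounds the projection error by \<open>k * norm q\<close>, so pairing
  with \<open>a\<close> loses at most \<open>k * u * (norm a)\<^sup>2\<close> from
  \<open>a \<bullet> q\<close>. Clearing the denominator of \<open>t\<close> gives the
  claim.\<close>

lemma projection_inner_lower_bound:
  fixes a q r :: "'a::real_inner"
  assumes r: "r \<noteq> 0" and k: "0 \<le> k"
    and deficit: "(norm q)\<^sup>2 * (norm r)\<^sup>2 - (q \<bullet> r)\<^sup>2 \<le> k\<^sup>2 * (norm q)\<^sup>2 * (norm r)\<^sup>2"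
    and lower: "l * (norm a)\<^sup>2 \<le> a \<bullet> q" and upper: "norm q \<le> u * norm a"
  shows "(l - k * u) * (norm a)\<^sup>2 * (norm r)\<^sup>2 \<le> (q \<bullet> r) * (a \<bullet> r)"
proof -
  define t where "t = (q \<bullet> r) / (norm r)\<^sup>2"
  have r2: "(norm r)\<^sup>2 > 0" using r by simp
  have "(norm (t *\<^sub>R r - q))\<^sup>2 = t * t * (norm r)\<^sup>2 - 2 * t * (q \<bullet> r) + (norm q)\<^sup>2"
    unfolding power2_norm_eq_inner
    by (simp add: inner_diff inner_commute algebra_simps)
  also have "\<dots> = (norm q)\<^sup>2 - (q \<bullet> r)\<^sup>2 / (norm r)\<^sup>2"
    using r2 by (simp add: t_def field_simps power2_eq_square)
  also have "\<dots> \<le> (k * norm q)\<^sup>2"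
    using deficit r2 by (simp add: field_simps)
  finally have "norm (t *\<^sub>R r - q) \<le> k * norm q"
    by (rule power2_le_imp_le) (simp add: k)
  also have "\<dots> \<le> k * (u * norm a)"
    using upper k by (rule mult_left_mono)
  finally have "norm a * norm (t *\<^sub>R r - q) \<le> norm a * (k * (u * norm a))"
    by (rule mult_left_mono) simp
  moreover have "\<bar>a \<bullet> (t *\<^sub>R r - q)\<bar> \<le> norm a * norm (t *\<^sub>R r - q)"
    by (rule Cauchy_Schwarz_ineq2)
  ultimately have "(l - k * u) * (norm a)\<^sup>2 \<le> a \<bullet> q + a \<bullet> (t *\<^sub>R r - q)"
    using lower by (simp add: algebra_simps power2_eq_square)
  also have "\<dots> = t * (a \<bullet> r)"
    by (simp add: inner_diff_right)
  finally have "(l - k * u) * (norm a)\<^sup>2 * (norm r)\<^sup>2 \<le> t * (a \<bullet> r) * (norm r)\<^sup>2"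
    by (rule mult_right_mono) simp
  then show ?thesis
    using r2 by (simp add: t_def)
qed

text \<open>The angle between \<open>q\<close> and \<open>r\<close> has sine at most \<open>k\<close>. This condition is symmetric in \<open>q\<close> and
  \<open>r\<close>, so projecting either vector on the line of the other gives one lower bound in terms of
  \<open>norm a\<close> and one in terms of \<open>norm b\<close>; their geometric mean is the claim.\<close>

lemma inner_ge_norm_mult_norm:
  fixes a b q r :: "'a::real_inner"
  assumes near: "norm (r - q) \<le> k * norm q" and k: "0 \<le> k" "k < 1"
    and a: "l * (norm a)\<^sup>2 \<le> a \<bullet> q" "norm q \<le> u * norm a"
    and b: "l * (norm b)\<^sup>2 \<le> b \<bullet> r" "norm r \<le> u * norm b"
    and sym: "a \<bullet> r = b \<bullet> q" and c: "0 \<le> l - k * u"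
  shows "(l - k * u) * (norm a * norm b) \<le> a \<bullet> r"
proof (cases "q = 0")
  case True
  then have "r = 0" using near by simp
  \<comment> \<open>For nonzero \<open>a\<close>, the bounds at \<open>q = 0\<close> force
    \<open>l \<le> 0 \<le> u\<close>, hence \<open>l - k * u \<le> 0\<close>, and \<open>c\<close>
    leaves only equality.\<close>
  have "a = 0 \<or> l - k * u = 0"
  proof (cases "a = 0")
    case False
    then have "l \<le> 0" "0 \<le> u"
      using True a by (auto simp: mult_le_0_iff zero_le_mult_iff)
    then show ?thesis using c k mult_nonneg_nonneg[of k u] by linarith
  qed simp
  then show ?thesis using \<open>r = 0\<close> by auto
next
  case False
  have "k * norm q < norm q" using False k by simp
  with near have qr: "0 < q \<bullet> r"
    by (intro inner_pos_of_norm_diff_less) linarith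
  then have r0: "r \<noteq> 0" by auto
  note def = inner_sq_deficit[OF near]
  have 1: "(l - k * u) * (norm a)\<^sup>2 * (norm r)\<^sup>2 \<le> (q \<bullet> r) * (a \<bullet> r)"
    by (rule projection_inner_lower_bound[OF r0 k(1) def a])
  have 2: "(l - k * u) * (norm b)\<^sup>2 * (norm q)\<^sup>2 \<le> (q \<bullet> r) * (a \<bullet> r)"
    unfolding sym inner_commute[of q r]
    by (rule projection_inner_lower_bound[OF False k(1) _ b])
      (use def in \<open>simp add: inner_commute mult.commute mult.left_commute\<close>)
  have "0 \<le> (l - k * u) * (norm a)\<^sup>2 * (norm r)\<^sup>2"
    using c by simp
  also note 1
  finally have ar: "0 \<le> a \<bullet> r"
    using qr by (simp add: zero_le_mult_iff)
  have "((l - k * u) * (norm a * norm b))\<^sup>2 * ((norm q)\<^sup>2 * (norm r)\<^sup>2)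
      = ((l - k * u) * (norm a)\<^sup>2 * (norm r)\<^sup>2) * ((l - k * u) * (norm b)\<^sup>2 * (norm q)\<^sup>2)"
    by (simp add: power2_eq_square)
  also have "\<dots> \<le> ((q \<bullet> r) * (a \<bullet> r)) * ((q \<bullet> r) * (a \<bullet> r))"
    by (rule mult_mono[OF 1 2]) (use qr ar c in auto)
  also have "\<dots> = (a \<bullet> r)\<^sup>2 * (q \<bullet> r)\<^sup>2"
    by (simp add: power2_eq_square)
  \<comment> \<open>Cauchy-Schwarz replaces \<open>(q \<bullet> r)\<^sup>2\<close> by the positive
    factor on the left of the chain, which then cancels.\<close>
  also have "\<dots> \<le> (a \<bullet> r)\<^sup>2 * ((norm q)\<^sup>2 * (norm r)\<^sup>2)"
    using Cauchy_Schwarz_ineq[of q r] by (intro mult_left_mono) (simp_all add: power2_norm_eq_inner)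
  finally have "((l - k * u) * (norm a * norm b))\<^sup>2 \<le> (a \<bullet> r)\<^sup>2"
    using False r0 by simp
  then show ?thesis
    using ar by (rule power2_le_imp_le)
qed

section \<open>Positive semidefinite matrices and operator norm bounds\<close>

text \<open>Discriminant argument for the binary quadratic form \<open>quad\<close>, kept
  homogeneous in \<open>c\<close> and \<open>d\<close> to avoid dividing by
  \<open>s\<close>.\<close>

lemma pos_semidef_Cauchy_Schwarz:
  fixes A :: "real^'n^'n"
  assumes "pos_semidef A"
  shows "(x \<bullet> (A *v y))\<^sup>2 \<le> (x \<bullet> (A *v x)) * (y \<bullet> (A *v y))"
proof -
  have sym: "y \<bullet> (A *v x) = x \<bullet> (A *v y)" for x y
    using assms unfolding pos_semidef_def by (metis dot_lmul_matrix inner_commute transpose_matrix_vector)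
  define p q s where "p = x \<bullet> (A *v x)" and "q = x \<bullet> (A *v y)" and "s = y \<bullet> (A *v y)"
  have quad: "0 \<le> c * c * p + 2 * c * d * q + d * d * s" for c d
  proof -
    have "0 \<le> (c *\<^sub>R x + d *\<^sub>R y) \<bullet> (A *v (c *\<^sub>R x + d *\<^sub>R y))"
      using assms unfolding pos_semidef_def by blast
    then show ?thesis
      by (simp add: p_def q_def s_def matrix_vector_right_distrib inner_add inner_distrib
          matrix_vector_mult_scaleR sym[of y x] algebra_simps)
  qed
  have "0 \<le> p" "0 \<le> s" using quad[of 1 0] quad[of 0 1] by simp_all
  have "q\<^sup>2 \<le> p * s"
  proof (cases "s = 0")
    case True
    have "q = 0"
    proof (rule ccontr)
      assume "q \<noteq> 0"
      \<comment> \<open>For \<open>s = 0\<close> the form is affine in \<open>d\<close>; this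
        \<open>d\<close> gives it the value \<open>-1\<close>.\<close>
      with quad[of 1 "- (p + 1) / (2 * q)"] True \<open>0 \<le> p\<close> show False by (simp add: field_simps)
    qed
    then show ?thesis using True by simp
  next
    case False
    have "0 \<le> s * (p * s - q\<^sup>2)"
      using quad[of s "- q"] by (simp add: algebra_simps power2_eq_square)
    then show ?thesis using False \<open>0 \<le> s\<close> by (simp add: zero_le_mult_iff)
  qed
  then show ?thesis by (simp add: p_def q_def s_def)
qed

lemma mat_vector_mult: "mat c *v (x :: real^'n) = c *\<^sub>R x"
  by (simp add: mat_def matrix_vector_mult_def vec_eq_iff if_distrib[where f="\<lambda>y. y * z" for z]
      cong: if_cong)

lemma loewner_le_iff:
  "A \<preceq>\<^sub>L B \<longleftrightarrow> transpose (B - A) = B - A \<and> (\<forall>x. x \<bullet> (A *v x) \<le> x \<bullet> (B *v x))"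
  by (simp add: loewner_le_def pos_semidef_def matrix_vector_mult_diff_rdistrib inner_diff_right)

text \<open>Cauchy-Schwarz for the form of \<open>A\<close>, applied to \<open>A *v x\<close> and
  \<open>x\<close>, bounds the fourth power of \<open>norm (A *v x)\<close> by two values of the
  form. Bounding each by \<open>u\<close> and cancelling \<open>(norm (A *v x))\<^sup>2\<close>
  gives the claim without diagonalizing \<open>A\<close>.\<close>

lemma norm_matrix_vector_le_of_loewner:
  fixes A :: "real^'n^'n"
  assumes psd: "pos_semidef A" and le: "A \<preceq>\<^sub>L mat u" and u: "0 \<le> u"
  shows "norm (A *v x) \<le> u * norm x"
proof (cases "A *v x = 0")
  case False
  have quad: "y \<bullet> (A *v y) \<le> u * (norm y)\<^sup>2" for y
    using le by (simp add: loewner_le_iff mat_vector_mult power2_norm_eq_inner)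
  let ?y = "A *v x"
  have "((norm ?y)\<^sup>2)\<^sup>2 \<le> (?y \<bullet> (A *v ?y)) * (x \<bullet> ?y)"
    using pos_semidef_Cauchy_Schwarz[OF psd, of ?y x] by (simp add: power2_norm_eq_inner)
  also have "\<dots> \<le> (u * (norm ?y)\<^sup>2) * (u * (norm x)\<^sup>2)"
    using psd u by (intro mult_mono quad) (auto simp: pos_semidef_def)
  also have "\<dots> = (u * norm x)\<^sup>2 * (norm ?y)\<^sup>2"
    by (simp add: power2_eq_square)
  finally have "(norm ?y)\<^sup>2 * (norm ?y)\<^sup>2 \<le> (u * norm x)\<^sup>2 * (norm ?y)\<^sup>2"
    by (simp add: power2_eq_square)
  then have "(norm ?y)\<^sup>2 \<le> (u * norm x)\<^sup>2"
    by (rule mult_right_le_imp_le) (simp add: False)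
  then show ?thesis
    by (rule power2_le_imp_le) (use u in simp)
qed (use u in simp)

lemma norm_vector_matrix_le:
  fixes A :: "real^'n^'m"
  assumes "\<And>x. norm (A *v x) \<le> k * norm x"
  shows "norm (y v* A) \<le> k * norm y"
proof (cases "y v* A = 0")
  case True
  \<comment> \<open>Testing the assumption on a unit vector shows that \<open>k\<close> is
    nonnegative.\<close>
  have "0 \<le> k * norm (axis undefined 1 :: real^'n)"
    using assms norm_ge_zero order_trans by blast
  then show ?thesis using True by simp
next
  case False
  have "norm (y v* A) * norm (y v* A) = y \<bullet> (A *v (y v* A))"
    by (simp add: dot_lmul_matrix[symmetric] flip: power2_norm_eq_inner power2_eq_square)
  also have "\<dots> \<le> norm y * norm (A *v (y v* A))"
    by (rule norm_cauchy_schwarz)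
  also have "\<dots> \<le> norm y * (k * norm (y v* A))"
    by (intro mult_left_mono assms) simp
  finally show ?thesis using False by (simp add: mult.commute mult.left_commute)
qed

section \<open>Singular values and invertibility of the Gram matrix\<close>

text \<open>Eigenvectors of distinct eigenvalues are orthogonal, hence independent, and a
  finite-dimensional space holds only finitely many. This makes the \<open>Min\<close> in
  \<open>sigma_min\<close> a minimum over a finite set.\<close>

lemma finite_eigenvalues_symmetric:
  fixes A :: "real^'n^'n"
  assumes sym: "transpose A = A"
  shows "finite {c. is_eigenvalue A c}"
proof -
  define e where "e c = (SOME x. x \<noteq> 0 \<and> A *v x = c *\<^sub>R x)" for c
  let ?E = "{c. is_eigenvalue A c}"
  have e: "e c \<noteq> 0" "A *v e c = c *\<^sub>R e c" if "c \<in> ?E" for c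
    using that someI_ex[of "\<lambda>x. x \<noteq> 0 \<and> A *v x = c *\<^sub>R x"]
    by (auto simp: is_eigenvalue_def e_def)
  have orth: "e c \<bullet> e d = 0" if "c \<in> ?E" "d \<in> ?E" "c \<noteq> d" for c d
  proof -
    have "c * (e c \<bullet> e d) = (A *v e c) \<bullet> e d"
      using e that by simp
    also have "\<dots> = e c \<bullet> (A *v e d)"
      by (metis dot_lmul_matrix sym transpose_matrix_vector)
    also have "\<dots> = d * (e c \<bullet> e d)"
      using e that by simp
    finally show ?thesis using that by simp
  qed
  have "pairwise orthogonal (e ` ?E)"
    unfolding pairwise_def orthogonal_def using orth by blast
  moreover have "0 \<notin> e ` ?E"
    using e by force
  ultimately have "finite (e ` ?E)"
    using pairwise_orthogonal_independent independent_imp_finite by blast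
  moreover have "inj_on e ?E"
    using orth e by (metis inj_onI inner_eq_zero_iff)
  ultimately show ?thesis
    using finite_imageD by blast
qed

text \<open>A nonzero kernel vector of the Gram matrix would make \<open>0\<close> a singular
  value.\<close>

lemma invertible_gram_of_sigma_min_pos:
  fixes M :: "real^'p^'m"
  assumes "0 < sigma_min M"
  shows "invertible (M ** transpose M)"
proof -
  let ?K = "M ** transpose M"
  have "transpose ?K = ?K" by (simp add: matrix_transpose_mul)
  then have "finite {c. is_eigenvalue ?K c}"
    by (rule finite_eigenvalues_symmetric)
  then have "finite {s. 0 \<le> s \<and> s\<^sup>2 \<in> {c. is_eigenvalue ?K c}}"
    by (rule finite_subset[rotated, OF finite_imageI[of _ sqrt]]) (force simp: image_iff)
  then have fin: "finite (singular_values M)"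
    by (simp add: singular_values_def)
  have "x = 0" if "?K *v x = 0" for x
  proof (rule ccontr)
    assume "x \<noteq> 0"
    then have "0 \<in> singular_values M"
      using that by (auto simp: singular_values_def is_eigenvalue_def)
    then have "sigma_min M \<le> 0"
      unfolding sigma_min_def using fin by (rule Min_le[rotated])
    with assms show False by simp
  qed
  then show ?thesis
    by (simp add: invertible_left_inverse matrix_left_invertible_ker)
qed

lemma matrix_inv_inverse:
  fixes A :: "real^'n^'n"
  assumes "invertible A"
  shows "A ** matrix_inv A = mat 1" "matrix_inv A ** A = mat 1"
  using someI_ex[of "\<lambda>B. A ** B = mat 1 \<and> B ** A = mat 1"] assms
  by (auto simp: matrix_inv_def invertible_def)

section \<open>Derivatives of contractions\<close>

text \<open>On a short step along \<open>h\<close> the derivative differs from the increment of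
  \<open>f\<close> by a factor \<open>e\<close> times the step length, and the increment is
  controlled by \<open>k\<close>. Then \<open>e\<close> tends to \<open>0\<close>.\<close>

lemma norm_derivative_le_lipschitz:
  fixes f :: "'a::real_normed_vector \<Rightarrow> 'b::real_normed_vector"
  assumes f: "(f has_derivative D) (at x)" and lip: "k-lipschitz_on UNIV f"
  shows "norm (D h) \<le> k * norm h"
proof -
  interpret D: bounded_linear D using f by (rule has_derivative_bounded_linear)
  show ?thesis
  proof (cases "h = 0")
    case False
    have "norm (D h) \<le> (k + e) * norm h" if "0 < e" for e
    proof -
      obtain d where d: "0 < d"
        and le: "\<And>y. norm (y - x) < d \<Longrightarrow> norm (f y - f x - D (y - x)) \<le> e * norm (y - x)"
        using f \<open>0 < e\<close> unfolding has_derivative_at_alt by blast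
      \<comment> \<open>The step \<open>s *\<^sub>R h\<close> has length
        \<open>d / 2\<close>.\<close>
      define s where "s = d / (2 * norm h)"
      have s: "0 < s" "norm (s *\<^sub>R h) < d" using d False by (auto simp: s_def)
      have "norm (D (s *\<^sub>R h)) \<le> norm (f (x + s *\<^sub>R h) - f x)
          + norm (f (x + s *\<^sub>R h) - f x - D (s *\<^sub>R h))"
        using norm_triangle_ineq4[of "f (x + s *\<^sub>R h) - f x" "f (x + s *\<^sub>R h) - f x - D (s *\<^sub>R h)"]
        by simp
      also have "\<dots> \<le> k * norm (s *\<^sub>R h) + e * norm (s *\<^sub>R h)"
        using le[of "x + s *\<^sub>R h"] s(2) lipschitz_onD[OF lip, of "x + s *\<^sub>R h" x]
        by (intro add_mono) (auto simp: dist_norm)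
      also have "\<dots> = s * ((k + e) * norm h)"
        using s by (simp add: algebra_simps)
      finally have "s * norm (D h) \<le> s * ((k + e) * norm h)"
        using s by (simp add: D.scaleR)
      then show ?thesis using s by simp
    qed
    note bound = this
    have "norm (D h) \<le> k * norm h + e" if "0 < e" for e
    proof -
      have "norm (D h) \<le> (k + e / norm h) * norm h"
        by (rule bound) (use that False in simp)
      also have "\<dots> = k * norm h + e"
        using False by (simp add: distrib_right)
      finally show ?thesis .
    qed
    then show ?thesis by (rule field_le_epsilon)
  qed (simp add: D.zero)
qed

text \<open>A kernel vector would be a fixed point of the strict linear contraction
  \<open>D\<close>. Thus the \<open>matrix_inv\<close> in the implicit derivative is a genuine
  inverse.\<close>

lemma invertible_one_minus:
  fixes D :: "real^'n^'n"
  assumes "\<And>x. norm (D *v x) \<le> k * norm x" and "k < 1"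
  shows "invertible (mat 1 - D)"
proof -
  have "x = 0" if "(mat 1 - D) *v x = 0" for x
  proof -
    have "D *v x = x"
      using that by (simp add: matrix_vector_mult_diff_rdistrib)
    then have "(1 - k) * norm x \<le> 0"
      using assms(1)[of x] by (simp add: algebra_simps)
    then show ?thesis using assms(2) by (simp add: mult_le_0_iff)
  qed
  then show ?thesis
    by (simp add: invertible_left_inverse matrix_left_invertible_ker)
qed

section \<open>The pointwise estimate\<close>

text \<open>An instance of \<open>inner_ge_norm_mult_norm\<close> with \<open>q = g\<close>,
  \<open>r = h\<close>, \<open>a = M *v v\<close> and \<open>b = M *v w\<close>. Since
  \<open>B\<close> inverts the Gram matrix, it maps \<open>a\<close> to \<open>g\<close> and
  \<open>b\<close> to \<open>h\<close>, so the bounds on \<open>B\<close> become those required of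
  the two pairs.\<close>

lemma inner_sensitivity_lower_bound:
  fixes M :: "real^'p^'m" and D :: "real^'m^'m" and h :: "real^'m"
  defines "B \<equiv> matrix_inv (M ** transpose M)"
    and "v \<equiv> transpose (matrix_inv (mat 1 - D) ** M) *v h"
    and "w \<equiv> transpose M *v h"
  assumes inv: "invertible (M ** transpose M)"
    and D: "\<And>x. norm (D *v x) \<le> k * norm x" and k: "0 \<le> k" "k < 1"
    and B: "mat l \<preceq>\<^sub>L B" "B \<preceq>\<^sub>L mat u" and l: "0 \<le> l" and u: "0 \<le> u"
    and c: "0 \<le> l - k * u"
  shows "(l - k * u) * (norm (M *v v) * norm (M *v w)) \<le> v \<bullet> w"
proof -
  define g where "g = transpose (matrix_inv (mat 1 - D)) *v h"
  have v: "v = transpose M *v g"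
    unfolding v_def g_def matrix_transpose_mul matrix_vector_mul_assoc ..
  have transpose_diff: "transpose (X - Y) = transpose X - transpose Y" for X Y :: "real^'m^'m"
    by (simp add: transpose_def vec_eq_iff)
  have BMt: "B *v (M *v (transpose M *v y)) = y" for y
    using matrix_inv_inverse(2)[OF inv] by (simp only: matrix_vector_mul_assoc B_def matrix_vector_mul_lid)
  have lower: "l * (norm x)\<^sup>2 \<le> x \<bullet> (B *v x)" for x
    using B(1) by (simp add: loewner_le_iff mat_vector_mult power2_norm_eq_inner)
  \<comment> \<open>The order only makes \<open>B - mat l\<close> symmetric; symmetry of
    \<open>B\<close> follows because \<open>mat l\<close> is symmetric.\<close>
  have "pos_semidef B"
    unfolding pos_semidef_def
  proof (intro conjI allI)
    show "transpose B = B"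
      using B(1) by (simp add: loewner_le_iff transpose_diff)
    show "0 \<le> x \<bullet> (B *v x)" for x
      using l by (intro order_trans[OF _ lower]) simp
  qed
  then have upper: "norm (B *v x) \<le> u * norm x" for x
    using B(2) u by (rule norm_matrix_vector_le_of_loewner)
  have "transpose (mat 1 - D) *v g = h"
    unfolding g_def matrix_vector_mul_assoc matrix_transpose_mul[symmetric]
      matrix_inv_inverse(2)[OF invertible_one_minus[OF D k(2)]] by simp
  \<comment> \<open>The transpose of \<open>D\<close> inherits the norm bound of \<open>D\<close>,
    so this identity puts \<open>h\<close> within \<open>k * norm g\<close> of
    \<open>g\<close>.\<close>
  then have "h - g = - (transpose D *v g)"
    unfolding transpose_diff matrix_vector_mult_diff_rdistrib transpose_mat matrix_vector_mul_lid
    by (simp add: algebra_simps)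
  then have near: "norm (h - g) \<le> k * norm g"
    using norm_vector_matrix_le[OF D] by simp
  have adj: "(M *v x) \<bullet> y = x \<bullet> (transpose M *v y)" for x y
    by (metis dot_lmul_matrix inner_commute transpose_matrix_vector)
  have vw: "v \<bullet> w = (M *v v) \<bullet> h"
    by (simp only: adj w_def)
  show ?thesis
    unfolding vw
  proof (rule inner_ge_norm_mult_norm[OF near k _ _ _ _ _ c])
    show "l * (norm (M *v v))\<^sup>2 \<le> (M *v v) \<bullet> g"
      using lower[of "M *v v"] by (simp only: v BMt)
    show "norm g \<le> u * norm (M *v v)"
      using upper[of "M *v v"] by (simp only: v BMt)
    show "l * (norm (M *v w))\<^sup>2 \<le> (M *v w) \<bullet> h"
      using lower[of "M *v w"] by (simp only: w_def BMt)
    show "norm h \<le> u * norm (M *v w)"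
      using upper[of "M *v w"] by (simp only: w_def BMt)
    show "(M *v v) \<bullet> h = (M *v w) \<bullet> g"
      using vw adj[of w g] by (simp only: v[symmetric] inner_commute)
  qed
qed

section \<open>Square-integrable functions and their means\<close>

lemma integrable_mult_of_square_integrable:
  fixes f g :: "'a \<Rightarrow> real"
  assumes [measurable]: "f \<in> borel_measurable M" "g \<in> borel_measurable M"
    and "integrable M (\<lambda>x. (f x)\<^sup>2)" "integrable M (\<lambda>x. (g x)\<^sup>2)"
  shows "integrable M (\<lambda>x. f x * g x)"
proof (rule Bochner_Integration.integrable_bound)
  show "integrable M (\<lambda>x. (f x)\<^sup>2 + (g x)\<^sup>2)"
    using assms by simp
  have "\<bar>a * b\<bar> \<le> \<bar>a\<^sup>2 + b\<^sup>2\<bar>" for a b :: real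
    using sum_squares_bound[of "\<bar>a\<bar>" "\<bar>b\<bar>"] abs_ge_zero[of "a * b"]
    unfolding abs_mult power2_abs by linarith
  then show "AE x in M. norm (f x * g x) \<le> norm ((f x)\<^sup>2 + (g x)\<^sup>2)"
    by simp
qed measurable

lemma integrable_vec_iff:
  fixes f :: "'a \<Rightarrow> real^'n"
  shows "integrable M f \<longleftrightarrow> (\<forall>i. integrable M (\<lambda>x. f x $ i))"
proof
  assume "integrable M f"
  then show "\<forall>i. integrable M (\<lambda>x. f x $ i)"
    by (auto intro: integrable_bounded_linear[OF bounded_linear_vec_nth])
next
  assume "\<forall>i. integrable M (\<lambda>x. f x $ i)"
  then have "integrable M (\<lambda>x. \<Sum>i\<in>UNIV. f x $ i *\<^sub>R axis i 1)"
    by (intro Bochner_Integration.integrable_sum integrable_scaleR_left) auto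
  moreover have "(\<lambda>x. \<Sum>i\<in>UNIV. f x $ i *\<^sub>R axis i 1) = f"
    by (simp add: basis_expansion flip: scalar_mult_eq_scaleR)
  ultimately show "integrable M f" by (rule back_subst[where P="integrable M"])
qed

text \<open>Covariance identity: as \<open>c\<close> and \<open>d\<close> are the means, the
  integral of \<open>(f x - c) \<bullet> (g x - d)\<close> is that of
  \<open>f x \<bullet> g x\<close> minus \<open>c \<bullet> d\<close> times the total mass. By
  Cauchy-Schwarz and \<open>less\<close> it is strictly below the integral of
  \<open>f x \<bullet> g x\<close>, whence \<open>c \<bullet> d\<close> is positive.\<close>

lemma (in finite_measure) inner_integrals_pos:
  fixes f g :: "'a \<Rightarrow> real^'n"
  assumes f: "\<And>i. (\<lambda>x. f x $ i) \<in> borel_measurable M" "\<And>i. integrable M (\<lambda>x. (f x $ i)\<^sup>2)"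
    and g: "\<And>i. (\<lambda>x. g x $ i) \<in> borel_measurable M" "\<And>i. integrable M (\<lambda>x. (g x $ i)\<^sup>2)"
    and mean: "integral\<^sup>L M f = measure M (space M) *\<^sub>R c" "integral\<^sup>L M g = measure M (space M) *\<^sub>R d"
    and less: "\<And>x. x \<in> space M \<Longrightarrow> norm (f x - c) * norm (g x - d) < f x \<bullet> g x"
    and pos: "0 < measure M (space M)"
  shows "0 < integral\<^sup>L M f \<bullet> integral\<^sup>L M g"
proof -
  let ?m = "measure M (space M)"
  \<comment> \<open>On a finite measure space the constant \<open>1\<close> is square integrable, so
    the product lemma applies with it as second factor.\<close>
  have "integrable M h" if "h \<in> borel_measurable M" "integrable M (\<lambda>x. (h x)\<^sup>2)" for h :: "'a \<Rightarrow> real"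
    using integrable_mult_of_square_integrable[of h M "\<lambda>_. 1"] that by simp
  then have int_f: "integrable M f" and int_g: "integrable M g"
    unfolding integrable_vec_iff using f g by blast+
  have int_fg: "integrable M (\<lambda>x. f x \<bullet> g x)"
    unfolding inner_vec_def inner_real_def
    by (intro Bochner_Integration.integrable_sum integrable_mult_of_square_integrable f g)
  have expand: "(f x - c) \<bullet> (g x - d) = f x \<bullet> g x - f x \<bullet> d - c \<bullet> g x + c \<bullet> d" for x
    by (simp add: inner_diff)
  have int_dev: "integrable M (\<lambda>x. (f x - c) \<bullet> (g x - d))"
    unfolding expand using int_f int_g int_fg by simp
  have "(f x - c) \<bullet> (g x - d) < f x \<bullet> g x" if "x \<in> space M" for x
    using norm_cauchy_schwarz less[OF that] by (rule le_less_trans)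
  then have "(\<integral>x. (f x - c) \<bullet> (g x - d) \<partial>M) < (\<integral>x. f x \<bullet> g x \<partial>M)"
    using pos by (intro integral_less_AE_space int_dev int_fg) (auto simp: measure_def)
  moreover have "(\<integral>x. (f x - c) \<bullet> (g x - d) \<partial>M) = (\<integral>x. f x \<bullet> g x \<partial>M) - ?m * (c \<bullet> d)"
    unfolding expand using int_f int_g int_fg by (simp add: mean)
  ultimately have "0 < ?m * (c \<bullet> d)"
    by simp
  then show ?thesis
    using pos by (simp add: mean)
qed

lemma inner_set_integrals_pos:
  fixes f g :: "real \<Rightarrow> real^'p"
  assumes T: "0 < T" and f: "L2_entrywise T f" and g: "L2_entrywise T g"
    and less: "\<And>t. t \<in> {0..T} \<Longrightarrow> norm (f t - time_mean T f) * norm (g t - time_mean T g) < f t \<bullet> g t"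
  shows "0 < (LINT t:{0..T}|lebesgue. f t) \<bullet> (LINT t:{0..T}|lebesgue. g t)"
proof -
  \<comment> \<open>Restricting the measure makes \<open>{0..T}\<close> the whole space, of mass
    \<open>T\<close>, so \<open>time_mean\<close> becomes the mean above.\<close>
  let ?M = "lebesgue_on {0..T}"
  have M: "finite_measure ?M" "measure ?M {0..T} = T"
    using T by (auto intro: finite_measure_lebesgue_on simp: measure_restrict_space)
  have eq: "(LINT t:{0..T}|lebesgue. h t) = integral\<^sup>L ?M h" for h :: "real \<Rightarrow> real^'p"
    by (simp add: set_lebesgue_integral_def integral_restrict_space)
  have L2: "(\<lambda>t. h t $ i) \<in> borel_measurable ?M" "integrable ?M (\<lambda>t. (h t $ i)\<^sup>2)"
    if "L2_entrywise T h" for h :: "real \<Rightarrow> real^'p" and i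
    using that by (simp_all add: L2_entrywise_def set_borel_measurable_def set_integrable_def
        borel_measurable_restrict_space_iff integrable_restrict_space)
  show ?thesis
    unfolding eq
    by (rule finite_measure.inner_integrals_pos[OF M(1) L2[OF f] L2[OF g], where c="time_mean T f" and d="time_mean T g"])
      (use T less in \<open>simp_all add: M(2) time_mean_def eq\<close>)
qed

section \<open>Gradients, differentiability in the control, and descent\<close>

lemma grad_eqI:
  assumes "GDERIV F x :> g"
  shows "grad F x = g"
  unfolding grad_def
proof (rule the_equality[where P="\<lambda>g. GDERIV F x :> g", OF assms])
  fix g' assume "GDERIV F x :> g'"
  then have "(\<lambda>h. h \<bullet> g') = (\<lambda>h. h \<bullet> g)"
    using assms unfolding gderiv_def by (rule has_derivative_unique)
  then show "g' = g"
    by (metis vector_eq_ldot)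
qed

text \<open>At the end points of the horizon the joint derivative is one-sided in time. The slice in
  \<open>u\<close> keeps \<open>t\<close> fixed and stays in the domain, so the chain rule still
  gives a full derivative at \<open>u\<close>.\<close>

lemma cont_diff_on_imp_differentiable_control:
  fixes F :: "'a::real_normed_vector \<times> 'b::real_normed_vector \<times> 'c::real_normed_vector \<times> 'd::real_normed_vector \<Rightarrow> 'e::real_normed_vector"
  assumes F: "cont_diff_on F (UNIV \<times> I \<times> UNIV \<times> UNIV)" and t: "t \<in> I"
  shows "(\<lambda>u. F (\<theta>, t, z, u)) differentiable (at u)"
proof -
  obtain D where "(F has_derivative D) (at (\<theta>, t, z, u) within UNIV \<times> I \<times> UNIV \<times> UNIV)"
    using F t unfolding cont_diff_on_def by blast
  then have "(F has_derivative D) (at (\<theta>, t, z, u) within range (\<lambda>u. (\<theta>, t, z, u)))"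
    by (rule has_derivative_subset) (use t in auto)
  moreover have "((\<lambda>u. (\<theta>, t, z, u)) has_derivative (\<lambda>h. (0, 0, 0, h))) (at u)"
    by (auto intro!: derivative_eq_intros)
  ultimately have "(F \<circ> (\<lambda>u. (\<theta>, t, z, u)) has_derivative D \<circ> (\<lambda>h. (0, 0, 0, h))) (at u)"
    by (rule diff_chain_within[rotated])
  then show ?thesis
    by (auto simp: differentiable_def comp_def)
qed

theorem theorem1:
  fixes C :: "('n::finite, 'm::finite, 'p::finite) control_problem"
    and us :: "real^'p \<Rightarrow> real \<Rightarrow> real^'n \<Rightarrow> real^'m"
    and zs ps :: "real^'p \<Rightarrow> real^'n \<Rightarrow> real \<Rightarrow> real^'n"
    and \<gamma> \<beta> \<eta> lam_minus lam_plus :: real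
  assumes regular: "regular_problem C"
    and control: "feedback_control C us"
    and trajectory: "state_trajectory C us zs"
    and adjoint: "adjoint_trajectory C us zs ps"
    and representation: "gradient_representation C us zs ps"
    and gamma: "0 < \<gamma>" "\<gamma> < 1"
    and contractive: "\<And>\<theta> t z. t \<in> {0..horizon C} \<Longrightarrow> \<gamma>-lipschitz_on UNIV (fp_map C \<theta> t z)"
    and C1: "cont_diff_on (\<lambda>(\<theta>, t, z, u). fp_map C \<theta> t z u) (UNIV \<times> {0..horizon C} \<times> UNIV \<times> UNIV)"
    and beta: "0 < \<beta>"
    and singular: "\<And>\<theta> t z u. t \<in> {0..horizon C} \<Longrightarrow>
        sqrt (\<gamma> / \<beta>) \<le> sigma_min (fp_map_dtheta C \<theta> t z u) \<and>
        sigma_min (fp_map_dtheta C \<theta> t z u) \<le> sigma_max (fp_map_dtheta C \<theta> t z u) \<and>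
        sigma_max (fp_map_dtheta C \<theta> t z u) \<le> 1 / sqrt \<beta>"
    and eta: "0 < \<eta>"
    and sensitivity: "\<And>\<theta> x t. t \<in> {0..horizon C} \<Longrightarrow>
        \<eta> \<le> norm (control_sensitivity C us zs ps \<theta> x t)"
    and lam: "0 < lam_minus" "lam_minus < lam_plus"
    and eigenvalue_bounds: "\<And>\<theta> t z u. t \<in> {0..horizon C} \<Longrightarrow>
        (let M = fp_map_dtheta C \<theta> t z u; B = matrix_inv (M ** transpose M)
         in mat lam_minus \<preceq>\<^sub>L B \<and> B \<preceq>\<^sub>L mat lam_plus)"
    and v_L2: "\<And>\<theta> x. L2_entrywise (horizon C) (v_fn C us zs ps \<theta> x)"
    and w_L2: "\<And>\<theta> x. L2_entrywise (horizon C) (w_fn C us zs ps \<theta> x)"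
    and v_deviation: "\<And>\<theta> x t. t \<in> {0..horizon C} \<Longrightarrow>
        norm (v_fn C us zs ps \<theta> x t - time_mean (horizon C) (v_fn C us zs ps \<theta> x))
        < norm (traj_dtheta C us zs \<theta> x t *v v_fn C us zs ps \<theta> x t)
          * sqrt (lam_minus - \<gamma> * lam_plus)"
    and w_deviation: "\<And>\<theta> x t. t \<in> {0..horizon C} \<Longrightarrow>
        norm (w_fn C us zs ps \<theta> x t - time_mean (horizon C) (w_fn C us zs ps \<theta> x))
        < norm (traj_dtheta C us zs \<theta> x t *v w_fn C us zs ps \<theta> x t)
          * sqrt (lam_minus - \<gamma> * lam_plus)"
  shows "\<forall>x \<theta>. descent_direction (control_objective C us zs x) \<theta> (- jfb_gradient C us zs ps x \<theta>)"
proof (intro allI)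
  fix x \<theta>
  let ?v = "v_fn C us zs ps \<theta> x" and ?w = "w_fn C us zs ps \<theta> x" and ?T = "horizon C"
  let ?J = "control_objective C us zs x"
  have T: "0 < ?T"
    using regular by (simp add: regular_problem_def)
  have "norm (?v t - time_mean ?T ?v) * norm (?w t - time_mean ?T ?w) < ?v t \<bullet> ?w t"
    if t: "t \<in> {0..?T}" for t
  proof -
    define z u where "z = zs \<theta> x t" and "u = us \<theta> t z"
    define M where "M = fp_map_dtheta C \<theta> t z u"
    define D where "D = fp_map_du C \<theta> t z u"
    let ?c = "lam_minus - \<gamma> * lam_plus"
    have traj: "traj_dtheta C us zs \<theta> x t = M"
      by (simp add: traj_dtheta_def M_def u_def z_def)
    have v: "?v t = transpose (matrix_inv (mat 1 - D) ** M) *v control_sensitivity C us zs ps \<theta> x t"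
      by (simp only: v_fn_def implicit_derivative_def M_def D_def u_def z_def)
    have w: "?w t = transpose M *v control_sensitivity C us zs ps \<theta> x t"
      by (simp only: w_fn_def traj)
    have dev_v: "norm (?v t - time_mean ?T ?v) < norm (M *v ?v t) * sqrt ?c"
      using v_deviation[OF t, of \<theta> x] by (simp only: traj)
    have dev_w: "norm (?w t - time_mean ?T ?w) < norm (M *v ?w t) * sqrt ?c"
      using w_deviation[OF t, of \<theta> x] by (simp only: traj)
    \<comment> \<open>The strict deviation bound has a nonnegative left side, so its right side is
      positive; this forces \<open>\<gamma> * lam_plus < lam_minus\<close>.\<close>
    have "0 < norm (M *v ?v t) * sqrt ?c"
      using norm_ge_zero dev_v by (rule le_less_trans)
    then have c: "0 < ?c"
      by (simp add: zero_less_mult_iff)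
    have "0 < sqrt (\<gamma> / \<beta>)"
      using gamma beta by simp
    then have inv: "invertible (M ** transpose M)"
      using singular[OF t, of \<theta> z u] unfolding M_def[symmetric]
      by (intro invertible_gram_of_sigma_min_pos) linarith
    have "fp_map C \<theta> t z differentiable (at u)"
      using cont_diff_on_imp_differentiable_control[OF C1 t] by simp
    then have D: "norm (D *v y) \<le> \<gamma> * norm y" for y
      unfolding jacobian_works D_def fp_map_du_def
      using norm_derivative_le_lipschitz contractive[OF t] by blast
    \<comment> \<open>Each deviation bound contributes one factor \<open>sqrt ?c\<close>; their
      product is the constant of the pointwise estimate.\<close>
    have "norm (?v t - time_mean ?T ?v) * norm (?w t - time_mean ?T ?w)
        < (norm (M *v ?v t) * sqrt ?c) * (norm (M *v ?w t) * sqrt ?c)"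
      using dev_v dev_w by (intro mult_strict_mono') simp_all
    also have "\<dots> = ?c * (norm (M *v ?v t) * norm (M *v ?w t))"
      using c by simp
    also have "\<dots> \<le> ?v t \<bullet> ?w t"
      unfolding v w
      using eigenvalue_bounds[OF t, of \<theta> z u, folded M_def] gamma lam c
      by (intro inner_sensitivity_lower_bound inv D) (simp_all add: Let_def)
    finally show ?thesis .
  qed
  then have pos: "0 < (LINT t:{0..?T}|lebesgue. ?v t) \<bullet> (LINT t:{0..?T}|lebesgue. ?w t)"
    by (rule inner_set_integrals_pos[OF T v_L2 w_L2])
  \<comment> \<open>The representation supplies both differentiability and the value of
    \<open>grad\<close>; pairing with the negated JFB gradient flips the sign of
    \<open>pos\<close>.\<close>
  have "GDERIV ?J \<theta> :> (LINT t:{0..?T}|lebesgue. ?v t)"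
    using representation by (simp add: gradient_representation_def)
  then show "descent_direction ?J \<theta> (- jfb_gradient C us zs ps x \<theta>)"
    using pos by (auto simp: descent_direction_def grad_eqI jfb_gradient_def gderiv_def differentiable_def)
qed

end
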